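(* Let $X,Y$ be Banach spaces, $\Omega\subseteq X$ a non-empty open convex set, $t:\Omega\to Y$ a Fréchet differentiable operator, $r>0$ and $V(x^*,r)\subseteq\Omega$. Suppose that $t(x^* )=0$, $t$ has a continuous derivative in $V(x^*,r)$, $[t'(x^* )]^{-1}$ exists, and $[t'(x^* )]^{-1}t'$ satisfies the center Lipschitz condition with the $L$-average $$\|[t'(x^* )]^{-1}(t'(x)-t'(x^* ))\|\le\int_0^{2\rho(x)}L(u)\,du\qquad\forall\,x\in V(x^*,r),$$ where $\rho(x)=\|x-x^*\|$ and $L$ is a positive integrable function on $(0,2r)$. Let $r$ satisfy $$\int_0^{2r}L(u)\,du\le\frac13.$$ Then for every $x_0\in V(x^*,r)$ the two-step Newton type method started at $x_0$ is convergent (to $x^*$), and for all $n\ge0$ $$\|y_n-x^*\|\le\frac{2\int_0^{2\rho(x_n)}L(u)\,du}{1-\int_0^{2\rho(x_n)}L(u)\,du}\rho(x_n)\le q_1\rho(x_n),$$ $$\|x_{n+1}-x^*\|\le\frac{\int_0^{2\rho(x_n)}L(u)\,du+\int_0^{2\rho(y_n)}L(u)\,du}{1-\int_0^{2\rho(x_n)}L(u)\,du}\rho(y_n)\le q_2q_1\rho(x_n),$$ where the quantities $$q_1=\frac{2\int_0^{2\rho(x_0)}L(u)\,du}{1-\int_0^{2\rho(x_0)}L(u)\,du},\qquad q_2=\frac{\int_0^{2\rho(x_0)}L(u)\,du+\int_0^{2\rho(y_0)}L(u)\,du}{1-\int_0^{2\rho(x_0)}L(u)\,du}$$ are less than $1$.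 Moreover, $$\|x_n-x^*\|\le(q_1q_2)^n\|x_0-x^*\|,\quad n=1,2,\dots.$$ Furthermore, suppose that the function $L_a$ defined by $L_a(f)=f^{1-a}L(f)$ is non-decreasing for some $a$ with $0\le a\le1$. Then $$\|x_n-x^*\|\le C^{(1+2a)^n-1}\|x_0-x^*\|,\quad n=1,2,\dots,\qquad C=q_1\frac{\rho(x_0)}{\rho(y_0)},$$ with the same $q_1$.
   Context: $V(x^*,r)=\{x:\|x-x^*\|<r\}$ is the open ball. The two-step Newton type method started at $x_0$ is, for $k\ge0$, $$y_k=x_k-[t'(x_k)]^{-1}t(x_k),\qquad x_{k+1}=y_k-[t'(x_k)]^{-1}t(y_k).$$ The bound involving $C$ is understood when $\rho(y_0)\ne0$. *)

theory Defs
  imports "HOL-Analysis.Analysis"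
begin

definition blinfun_invertible :: "('a::real_normed_vector \<Rightarrow>\<^sub>L 'b::real_normed_vector) \<Rightarrow> bool" where
  "blinfun_invertible A \<longleftrightarrow> (\<exists>B. B o\<^sub>L A = id_blinfun \<and> A o\<^sub>L B = id_blinfun)"

text \<open>The two-sided bounded inverse; unspecified when the operator is not invertible.\<close>

definition blinfun_inv :: "('a::real_normed_vector \<Rightarrow>\<^sub>L 'b::real_normed_vector) \<Rightarrow> ('b \<Rightarrow>\<^sub>L 'a)" where
  "blinfun_inv A = (THE B. B o\<^sub>L A = id_blinfun \<and> A o\<^sub>L B = id_blinfun)"

text \<open>One Newton substep based at \<open>x\<close>: the derivative is taken at \<open>x\<close>, the residual at \<open>z\<close>.\<close>

definition newton_substep ::
  "('a::real_normed_vector \<Rightarrow> 'b::real_normed_vector) \<Rightarrow> ('a \<Rightarrow> 'a \<Rightarrow>\<^sub>L 'b) \<Rightarrow> 'a \<Rightarrow> 'a \<Rightarrow> 'a" where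
  "newton_substep t t' x z = z - blinfun_inv (t' x) (t z)"

primrec two_step_x ::
  "('a::real_normed_vector \<Rightarrow> 'b::real_normed_vector) \<Rightarrow> ('a \<Rightarrow> 'a \<Rightarrow>\<^sub>L 'b) \<Rightarrow> 'a \<Rightarrow> nat \<Rightarrow> 'a" where
  "two_step_x t t' x0 0 = x0"
| "two_step_x t t' x0 (Suc k) =
     newton_substep t t' (two_step_x t t' x0 k)
       (newton_substep t t' (two_step_x t t' x0 k) (two_step_x t t' x0 k))"

definition two_step_y ::
  "('a::real_normed_vector \<Rightarrow> 'b::real_normed_vector) \<Rightarrow> ('a \<Rightarrow> 'a \<Rightarrow>\<^sub>L 'b) \<Rightarrow> 'a \<Rightarrow> nat \<Rightarrow> 'a" where
  "two_step_y t t' x0 k = newton_substep t t' (two_step_x t t' x0 k) (two_step_x t t' x0 k)"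

text \<open>The Lebesgue integral of \<open>L\<close> from \<open>0\<close> to \<open>2 s\<close>. The interval is open because \<open>L\<close> is only
  given on an open interval.\<close>

definition L_int :: "(real \<Rightarrow> real) \<Rightarrow> real \<Rightarrow> real" where
  "L_int L s = (LINT u:{0<..<2 * s}|lebesgue. L u)"

end

theory Submission
  imports Defs
begin

text \<open>
  Write \<open>\<rho> z = \<parallel>z - x\<^sup>*\<parallel>\<close>, \<open>\<omega> s\<close> for the integral of \<open>L\<close> over \<open>(0, 2 s)\<close>, \<open>A = t' x\<^sup>*\<close>, and
  \<open>E x = A\<^sup>-\<^sup>1 (t' x - A)\<close>, so that \<open>\<parallel>E x\<parallel> \<le> \<omega> (\<rho> x)\<close> by the center Lipschitz condition.

  A single estimate carries the proof. Since \<open>t' x = A (id + E x)\<close>, the Neumann argument inverts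
  \<open>t' x\<close> with \<open>\<parallel>(id + E x)\<^sup>-\<^sup>1\<parallel> \<le> 1 / (1 - \<omega> (\<rho> x))\<close>. The Newton substep based at \<open>x\<close> with
  residual at \<open>z\<close> then has the error
  \<open>(id + E x)\<^sup>-\<^sup>1 (E x (z - x\<^sup>*) - (A\<^sup>-\<^sup>1 t z - (z - x\<^sup>*)))\<close>.
  The map \<open>z \<mapsto> A\<^sup>-\<^sup>1 t z - (z - x\<^sup>*)\<close> vanishes at \<open>x\<^sup>*\<close> and has derivative \<open>E z\<close>, so by the mean
  value inequality it is bounded by \<open>\<omega> (\<rho> z) \<rho> z\<close>. Hence the error is at most
  \<open>(\<omega> (\<rho> x) + \<omega> (\<rho> z)) / (1 - \<omega> (\<rho> x)) \<cdot> \<rho> z\<close> (lemma \<open>newton_substep_error\<close>). Taking \<open>z = x\<^sub>n\<close>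
  gives the bound for \<open>y\<^sub>n\<close>, taking \<open>z = y\<^sub>n\<close> the bound for \<open>x\<^sub>n\<^sub>+\<^sub>1\<close>.

  What remains concerns only the numbers \<open>\<rho> x\<^sub>n\<close> and \<open>\<rho> y\<^sub>n\<close> (lemma \<open>two_step_majorant\<close>). As \<open>L\<close> is
  positive, \<open>\<omega>\<close> is strictly increasing, so \<open>\<omega> s < 1/3\<close> for \<open>s < r\<close>; this is exactly what makes
  both contraction factors less than \<open>1\<close>. The chain
  \<open>\<rho> x\<^sub>n \<ge> \<rho> y\<^sub>n \<ge> \<rho> x\<^sub>n\<^sub>+\<^sub>1 \<ge> \<rho> y\<^sub>n\<^sub>+\<^sub>1\<close> then lets the factors of step \<open>n\<close> be replaced by \<open>q\<^sub>1\<close> and \<open>q\<^sub>2\<close>.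

  For the last estimate, \<open>\<rho> y\<^sub>0 \<le> q\<^sub>1 \<rho> x\<^sub>0\<close> says that \<open>C \<ge> 1\<close>. The powers of \<open>C\<close> have non-negative
  exponents and are therefore at least \<open>1\<close>, so this bound follows from \<open>\<rho> x\<^sub>n \<le> \<rho> x\<^sub>0\<close>.
\<close>

section \<open>Inverses of bounded linear operators\<close>

lemma blinfun_compose_assoc: "(A o\<^sub>L B) o\<^sub>L C = A o\<^sub>L (B o\<^sub>L C)"
  by (rule blinfun_eqI) simp

lemma blinfun_compose_id:
  "id_blinfun o\<^sub>L A = A" "A o\<^sub>L id_blinfun = A"
  by (rule blinfun_eqI, simp)+

lemma blinfun_inv_eqI:
  assumes "B o\<^sub>L A = id_blinfun" and "A o\<^sub>L B = id_blinfun"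
  shows "blinfun_inv A = B"
  unfolding blinfun_inv_def
proof (rule the_equality)
  fix B' assume B': "B' o\<^sub>L A = id_blinfun \<and> A o\<^sub>L B' = id_blinfun"
  have "B' = B' o\<^sub>L (A o\<^sub>L B)" using assms by (simp add: blinfun_compose_id)
  also have "\<dots> = (B' o\<^sub>L A) o\<^sub>L B" by (simp add: blinfun_compose_assoc)
  finally show "B' = B" using B' by (simp add: blinfun_compose_id)
qed (use assms in simp)

lemma blinfun_invertible_inverse:
  assumes "blinfun_invertible A"
  shows "blinfun_inv A o\<^sub>L A = id_blinfun" and "A o\<^sub>L blinfun_inv A = id_blinfun"
  using assms blinfun_inv_eqI unfolding blinfun_invertible_def by metis+

text \<open>
  Instead of summing the Neumann series, the equation \<open>v + E v = b\<close> is solved for every \<open>b\<close> as the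
  fixed point of the contraction \<open>v \<mapsto> b - E v\<close>. Uniqueness of the fixed point makes the solution
  linear in \<open>b\<close>, and \<open>\<parallel>v\<parallel> \<le> \<parallel>b\<parallel> + \<parallel>E\<parallel> \<parallel>v\<parallel>\<close> bounds it.
\<close>

lemma neumann_inverse:
  fixes E :: "'a::banach \<Rightarrow>\<^sub>L 'a"
  assumes "norm E < 1"
  obtains G where "G o\<^sub>L (id_blinfun + E) = id_blinfun" "(id_blinfun + E) o\<^sub>L G = id_blinfun"
    "norm G \<le> 1 / (1 - norm E)"
proof -
  have "\<exists>!v. b - E v = v" for b
  proof -
    have "dist (b - E v) (b - E w) \<le> norm E * dist v w" for v w
      using norm_blinfun[of E "v - w"]
      by (simp add: dist_norm blinfun.diff_right norm_minus_commute)
    then show ?thesis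
      using banach_fix_type[of "norm E" "\<lambda>v. b - E v"] assms by simp
  qed
  then obtain g where g: "b - E (g b) = g b" and uniq: "b - E v = v \<Longrightarrow> v = g b" for b v
    by metis
  have bound: "norm (g b) \<le> norm b * (1 / (1 - norm E))" for b
  proof -
    have "norm (g b) \<le> norm b + norm (E (g b))"
      using norm_triangle_ineq4[of b "E (g b)"] by (simp add: g)
    also have "\<dots> \<le> norm b + norm E * norm (g b)"
      using norm_blinfun[of E "g b"] by simp
    finally have "norm (g b) * (1 - norm E) \<le> norm b" by (simp add: algebra_simps)
    then show ?thesis using assms by (simp add: pos_le_divide_eq)
  qed
  have lin: "bounded_linear g"
  proof (rule bounded_linear_intro)
    show "g (b + c) = g b + g c" for b c
      by (rule uniq[symmetric])
        (metis g blinfun.add_right add_diff_add)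
    show "g (k *\<^sub>R b) = k *\<^sub>R g b" for k b
      by (rule uniq[symmetric]) (metis g blinfun.scaleR_right scaleR_diff_right)
  qed (rule bound)
  define G where "G = Blinfun g"
  have G: "blinfun_apply G = g"
    unfolding G_def by (rule bounded_linear_Blinfun_apply[OF lin])
  show thesis
  proof
    show "G o\<^sub>L (id_blinfun + E) = id_blinfun"
      by (rule blinfun_eqI) (simp add: G blinfun.add_left uniq[symmetric])
    show "(id_blinfun + E) o\<^sub>L G = id_blinfun"
      by (rule blinfun_eqI) (metis G g blinfun.add_left blinfun_apply_blinfun_compose
          diff_add_cancel blinfun_apply_id_blinfun id_apply)
    show "norm G \<le> 1 / (1 - norm E)"
      by (rule norm_blinfun_bound) (use bound assms in \<open>simp_all add: G mult.commute\<close>)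
  qed
qed

text \<open>
  The perturbed operator factors as \<open>T = A (id + E)\<close>. Keeping the inverse \<open>G\<close> of \<open>id + E\<close> apart from
  \<open>A\<^sup>-\<^sup>1\<close> is essential: only \<open>G\<close> has a norm controlled by the hypothesis.
\<close>

lemma perturbed_inverse:
  fixes A T :: "'a::banach \<Rightarrow>\<^sub>L 'b::real_normed_vector"
  defines "E \<equiv> blinfun_inv A o\<^sub>L (T - A)"
  assumes A: "blinfun_invertible A" and E: "norm E < 1"
  obtains G where "blinfun_invertible T" "blinfun_inv T = G o\<^sub>L blinfun_inv A"
    "G o\<^sub>L (id_blinfun + E) = id_blinfun" "norm G \<le> 1 / (1 - norm E)"
proof -
  note inv = blinfun_invertible_inverse[OF A]
  obtain G where G: "G o\<^sub>L (id_blinfun + E) = id_blinfun" "(id_blinfun + E) o\<^sub>L G = id_blinfun"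
    "norm G \<le> 1 / (1 - norm E)"
    using neumann_inverse[OF E] .
  have inv_A: "blinfun_inv A (A v) = v" "A (blinfun_inv A w) = w" for v w
    using inv by (metis blinfun_apply_blinfun_compose blinfun_apply_id_blinfun id_apply)+
  have AT: "blinfun_inv A o\<^sub>L T = id_blinfun + E"
    by (rule blinfun_eqI)
      (simp add: E_def blinfun.add_left blinfun.diff_left blinfun.diff_right inv_A)
  have T: "T = A o\<^sub>L (id_blinfun + E)"
    unfolding AT[symmetric] by (rule blinfun_eqI) (simp add: inv_A)
  have left: "(G o\<^sub>L blinfun_inv A) o\<^sub>L T = id_blinfun"
    by (simp add: blinfun_compose_assoc AT G(1))
  have right: "T o\<^sub>L (G o\<^sub>L blinfun_inv A) = id_blinfun"
  proof -
    have "T o\<^sub>L (G o\<^sub>L blinfun_inv A) = A o\<^sub>L (((id_blinfun + E) o\<^sub>L G) o\<^sub>L blinfun_inv A)"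
      by (simp add: T blinfun_compose_assoc)
    then show ?thesis using G inv by (simp add: blinfun_compose_id)
  qed
  have "blinfun_invertible T"
    unfolding blinfun_invertible_def using left right by blast
  with blinfun_inv_eqI[OF left right] G that show thesis by blast
qed

section \<open>The error of a Newton substep\<close>

text \<open>
  Both halves of a step are instances: the predictor takes \<open>z = x\<close>, the corrector takes \<open>z\<close> to be
  the predicted point.
\<close>

lemma newton_substep_error:
  fixes t :: "'a::banach \<Rightarrow> 'b::real_normed_vector" and t' :: "'a \<Rightarrow> 'a \<Rightarrow>\<^sub>L 'b"
  assumes deriv: "\<And>v. v \<in> ball xs r \<Longrightarrow> (t has_derivative blinfun_apply (t' v)) (at v)"
    and root: "t xs = 0"
    and inv: "blinfun_invertible (t' xs)"
    and lip: "\<And>v. v \<in> ball xs r \<Longrightarrow>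
      norm (blinfun_inv (t' xs) o\<^sub>L (t' v - t' xs)) \<le> \<omega> (norm (v - xs))"
    and mono: "mono_on {0..<r} \<omega>"
    and x: "x \<in> ball xs r" and small: "\<omega> (norm (x - xs)) < 1"
    and z: "z \<in> ball xs r"
  shows "blinfun_invertible (t' x)"
    and "norm (newton_substep t t' x z - xs)
      \<le> (\<omega> (norm (x - xs)) + \<omega> (norm (z - xs))) / (1 - \<omega> (norm (x - xs))) * norm (z - xs)"
proof -
  define B where "B = blinfun_inv (t' xs)"
  define E where "E v = B o\<^sub>L (t' v - t' xs)" for v
  have E_le: "norm (E v) \<le> \<omega> (norm (v - xs))" if "v \<in> ball xs r" for v
    using lip[OF that] by (simp add: E_def B_def)
  have E_less: "norm (E x) < 1" using E_le[OF x] small by simp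
  obtain G where inv_x: "blinfun_invertible (t' x)" "blinfun_inv (t' x) = G o\<^sub>L B"
    and G: "G o\<^sub>L (id_blinfun + E x) = id_blinfun" "norm G \<le> 1 / (1 - norm (E x))"
    using perturbed_inverse[OF inv, of "t' x"] E_less unfolding E_def B_def by metis
  show "blinfun_invertible (t' x)" by (fact inv_x)
  have BA: "B (t' xs v) = v" for v
    using blinfun_invertible_inverse(1)[OF inv]
    by (metis B_def blinfun_apply_blinfun_compose blinfun_apply_id_blinfun id_apply)
  \<comment> \<open>The nonlinear remainder: \<open>t\<close> preconditioned by \<open>B\<close>, minus its linearization at the root.\<close>
  define h where "h v = B (t v) - (v - xs)" for v
  have "norm (h z - h xs) \<le> \<omega> (norm (z - xs)) * norm (z - xs)"
  proof (rule differentiable_bound[where S = "cball xs (norm (z - xs))"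
        and f' = "\<lambda>v. blinfun_apply (E v)"])
    fix v assume "v \<in> cball xs (norm (z - xs))"
    then have le: "norm (v - xs) \<le> norm (z - xs)"
      by (simp add: dist_norm norm_minus_commute)
    with z have v: "v \<in> ball xs r" by (simp add: dist_norm norm_minus_commute)
    have "(h has_derivative (\<lambda>d. B (t' v d) - d)) (at v)"
      unfolding h_def by (rule derivative_eq_intros deriv[OF v] refl | simp)+
    moreover have "(\<lambda>d. B (t' v d) - d) = blinfun_apply (E v)"
      by (simp add: fun_eq_iff E_def blinfun.diff_left blinfun.diff_right BA)
    ultimately show "(h has_derivative blinfun_apply (E v)) (at v within cball xs (norm (z - xs)))"
      by (simp add: has_derivative_at_withinI)
    have "\<omega> (norm (v - xs)) \<le> \<omega> (norm (z - xs))"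
      using mono_onD[OF mono, of "norm (v - xs)" "norm (z - xs)"] le z
      by (simp add: dist_norm norm_minus_commute)
    with E_le[OF v] show "onorm (blinfun_apply (E v)) \<le> \<omega> (norm (z - xs))"
      by (simp add: norm_blinfun.rep_eq)
  qed (auto simp: dist_norm norm_minus_commute)
  then have h: "norm (h z) \<le> \<omega> (norm (z - xs)) * norm (z - xs)"
    by (simp add: h_def root)
  have "newton_substep t t' x z - xs = (z - xs) - G (B (t z))"
    by (simp add: newton_substep_def inv_x)
  also have "\<dots> = G ((z - xs) + E x (z - xs)) - G (B (t z))"
    using arg_cong[OF G(1), of "\<lambda>F. blinfun_apply F (z - xs)"] by (simp add: blinfun.add_left)
  also have "\<dots> = G (E x (z - xs) - h z)"
    by (simp add: blinfun.diff_right[symmetric] h_def algebra_simps)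
  finally have error: "newton_substep t t' x z - xs = G (E x (z - xs) - h z)" .
  have "norm (E x (z - xs) - h z)
      \<le> (\<omega> (norm (x - xs)) + \<omega> (norm (z - xs))) * norm (z - xs)"
    using norm_triangle_ineq4[of "E x (z - xs)" "h z"] norm_blinfun[of "E x" "z - xs"] h
      mult_right_mono[OF E_le[OF x], of "norm (z - xs)"]
    by (simp add: distrib_right)
  moreover have "norm G \<le> 1 / (1 - \<omega> (norm (x - xs)))"
    by (rule order_trans[OF G(2)]) (use E_le[OF x] small in \<open>simp add: frac_le\<close>)
  ultimately have "norm (G (E x (z - xs) - h z)) \<le> 1 / (1 - \<omega> (norm (x - xs)))
      * ((\<omega> (norm (x - xs)) + \<omega> (norm (z - xs))) * norm (z - xs))"
    using small by (intro order_trans[OF norm_blinfun] mult_mono) auto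
  then show "norm (newton_substep t t' x z - xs)
      \<le> (\<omega> (norm (x - xs)) + \<omega> (norm (z - xs))) / (1 - \<omega> (norm (x - xs))) * norm (z - xs)"
    by (simp add: error)
qed

section \<open>Strict monotonicity of the averaged Lipschitz bound\<close>

lemma set_integral_pos:
  fixes f :: "'a \<Rightarrow> real"
  assumes int: "set_integrable M D f" and D: "D \<in> sets M" "D \<notin> null_sets M"
    and pos: "\<And>u. u \<in> D \<Longrightarrow> f u > 0"
  shows "(LINT u:D|M. f u) > 0"
proof -
  have nonneg: "AE u in M. 0 \<le> indicator D u *\<^sub>R f u"
    using pos by (auto simp: indicator_def less_imp_le)
  have "(LINT u:D|M. f u) \<noteq> 0"
  proof
    assume "(LINT u:D|M. f u) = 0"
    then have "AE u in M. indicator D u *\<^sub>R f u = 0"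
      using integral_nonneg_eq_0_iff_AE[OF int[unfolded set_integrable_def] nonneg]
      by (simp add: set_lebesgue_integral_def)
    then have "AE u in M. u \<notin> D"
      by (rule eventually_mono) (use pos in \<open>force simp: indicator_def split: if_splits\<close>)
    then show False using D AE_iff_null_sets[OF D(1)] by blast
  qed
  moreover have "(LINT u:D|M. f u) \<ge> 0"
    using integral_nonneg_AE[OF nonneg] by (simp add: set_lebesgue_integral_def)
  ultimately show ?thesis by simp
qed

lemma L_int_0: "L_int L 0 = 0"
  by (simp add: L_int_def set_lebesgue_integral_def)

text \<open>
  Strictness matters: it turns the bound at the radius \<open>r\<close> into a strict bound inside the ball.
\<close>

lemma strict_mono_on_L_int:
  assumes pos: "\<And>u. u \<in> {0<..<2 * r} \<Longrightarrow> L u > 0"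
    and int: "set_integrable lebesgue {0<..<2 * r} L"
  shows "strict_mono_on {0..r} (L_int L)"
proof (rule strict_mono_onI)
  fix s s' assume s: "s \<in> {0..r}" "s' \<in> {0..r}" "s < s'"
  define D where "D = {0<..<2 * s'} - {0<..<2 * s}"
  have [measurable]: "D \<in> sets lebesgue" by (simp add: D_def)
  have ints: "set_integrable lebesgue {0<..<2 * s} L" "set_integrable lebesgue D L"
    by (rule set_integrable_subset[OF int]; use s in \<open>auto simp: D_def\<close>)+
  have "D \<notin> null_sets lebesgue"
  proof
    assume "D \<in> null_sets lebesgue"
    moreover have "{2 * s<..<2 * s'} \<subseteq> D" using s by (auto simp: D_def)
    ultimately have "{2 * s<..<2 * s'} \<in> null_sets lebesgue"
      using null_sets_subset[of D lebesgue] by auto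
    then show False using s by (simp add: null_sets_def)
  qed
  then have "(LINT u:D|lebesgue. L u) > 0"
    by (intro set_integral_pos[OF ints(2)]) (use s pos in \<open>auto simp: D_def\<close>)
  moreover have "{0<..<2 * s'} = {0<..<2 * s} \<union> D" using s by (auto simp: D_def)
  then have "L_int L s' = L_int L s + (LINT u:D|lebesgue. L u)"
    unfolding L_int_def using set_integral_Un[OF _ ints] by (simp add: D_def)
  ultimately show "L_int L s < L_int L s'" by simp
qed

section \<open>The distances of the iterates from the root\<close>

text \<open>
  Here \<open>a n\<close> and \<open>b n\<close> stand for the distances of \<open>x\<^sub>n\<close> and \<open>y\<^sub>n\<close> from the root. The step estimates are
  only available while the iterates stay in the ball, so that they do is part of the induction.
  The factor of the corrector contains \<open>\<omega> (b n)\<close>. Replacing it by \<open>\<omega> (b 0)\<close> requires \<open>b n \<le> b 0\<close>,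
  which holds because \<open>b (Suc n) \<le> a (Suc n) \<le> b n\<close>.
\<close>

lemma two_step_majorant:
  fixes a b :: "nat \<Rightarrow> real" and \<omega> :: "real \<Rightarrow> real"
  assumes mono: "mono_on {0..<r} \<omega>"
    and \<omega>: "\<And>s. 0 \<le> s \<Longrightarrow> s < r \<Longrightarrow> 0 \<le> \<omega> s \<and> \<omega> s < 1 / 3"
    and nonneg: "\<And>n. 0 \<le> a n" "\<And>n. 0 \<le> b n"
    and a0: "a 0 < r"
    and predictor: "\<And>n. a n < r \<Longrightarrow> b n \<le> 2 * \<omega> (a n) / (1 - \<omega> (a n)) * a n"
    and corrector: "\<And>n. a n < r \<Longrightarrow> b n < r
      \<Longrightarrow> a (Suc n) \<le> (\<omega> (a n) + \<omega> (b n)) / (1 - \<omega> (a n)) * b n"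
  defines "q1 \<equiv> 2 * \<omega> (a 0) / (1 - \<omega> (a 0))"
    and "q2 \<equiv> (\<omega> (a 0) + \<omega> (b 0)) / (1 - \<omega> (a 0))"
  shows "a n \<le> a 0" and "b n \<le> a 0" and "0 \<le> q1" and "q1 < 1" and "0 \<le> q2" and "q2 < 1"
    and "2 * \<omega> (a n) / (1 - \<omega> (a n)) * a n \<le> q1 * a n"
    and "(\<omega> (a n) + \<omega> (b n)) / (1 - \<omega> (a n)) * b n \<le> q2 * q1 * a n"
    and "a n \<le> (q1 * q2) ^ n * a 0"
proof -
  have fac: "0 \<le> (\<omega> s + \<omega> s') / (1 - \<omega> s)" "(\<omega> s + \<omega> s') / (1 - \<omega> s) < 1"
    if "0 \<le> s" "s < r" "0 \<le> s'" "s' < r" for s s'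
    using \<omega>[of s] \<omega>[of s'] that by (simp_all add: field_simps)
  have fac_mono: "(\<omega> s + \<omega> s') / (1 - \<omega> s) \<le> (\<omega> u + \<omega> u') / (1 - \<omega> u)"
    if "0 \<le> s" "s \<le> u" "u < r" "0 \<le> s'" "s' \<le> u'" "u' < r" for s s' u u'
    using \<omega>[of s] \<omega>[of s'] \<omega>[of u] \<omega>[of u'] that
      mono_onD[OF mono, of s u] mono_onD[OF mono, of s' u']
    by (intro frac_le) auto
  have b_le: "b n \<le> a n" if "a n < r" for n
    using predictor[OF that] fac(2)[OF nonneg(1) that nonneg(1) that]
      mult_right_mono[OF less_imp_le nonneg(1), of _ 1 n]
    by (smt (verit, best) mult_1)
  have a_le: "a (Suc n) \<le> b n" if "a n < r" for n
  proof -
    have "b n < r" using b_le[OF that] that by simp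
    with corrector[OF that this] fac(2)[OF nonneg(1) that nonneg(2) this] show ?thesis
      using mult_right_mono[OF less_imp_le nonneg(2), of _ 1 n]
      by (smt (verit, best) mult_1)
  qed
  have chain: "a n \<le> a 0 \<and> b n \<le> b 0" for n
  proof (induction n)
    case (Suc n)
    then have "a n < r" using a0 by simp
    with a_le b_le have "a (Suc n) \<le> b n" "b n \<le> a n" by auto
    with Suc \<open>a n < r\<close> b_le[of "Suc n"] show ?case by linarith
  qed simp
  have a_r: "a n < r" and b_r: "b n < r" for n
    using chain[of n] a0 b_le[OF a0] by linarith+
  show "a n \<le> a 0" "b n \<le> a 0" using chain[of n] b_le[OF a0] by linarith+
  show q1: "0 \<le> q1" and "q1 < 1"
    using fac[OF nonneg(1) a0 nonneg(1) a0] by (simp_all add: q1_def)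
  show q2: "0 \<le> q2" and "q2 < 1"
    using fac[OF nonneg(1) a0 nonneg(2) b_r] by (simp_all add: q2_def)
  show pred: "2 * \<omega> (a n) / (1 - \<omega> (a n)) * a n \<le> q1 * a n" for n
    using mult_right_mono[OF fac_mono nonneg(1), of "a n" "a 0" "a n" "a 0"] chain a0 nonneg
    by (simp add: q1_def)
  show corr: "(\<omega> (a n) + \<omega> (b n)) / (1 - \<omega> (a n)) * b n \<le> q2 * q1 * a n" for n
  proof -
    have "b n \<le> q1 * a n" using predictor[OF a_r] pred by (rule order_trans)
    moreover have "(\<omega> (a n) + \<omega> (b n)) / (1 - \<omega> (a n)) \<le> q2"
      unfolding q2_def by (rule fac_mono) (use chain a0 b_r nonneg in auto)
    ultimately show ?thesis
      unfolding mult.assoc[of q2] by (intro mult_mono) (use q2 nonneg in auto)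
  qed
  show "a n \<le> (q1 * q2) ^ n * a 0"
  proof (induction n)
    case (Suc n)
    have "a (Suc n) \<le> q2 * q1 * a n"
      using corrector[OF a_r b_r] corr by (rule order_trans)
    also have "\<dots> \<le> q2 * q1 * ((q1 * q2) ^ n * a 0)"
      using Suc q1 q2 by (intro mult_left_mono) auto
    finally show ?case by (simp add: mult_ac)
  qed simp
qed

section \<open>Convergence of the two-step method\<close>

theorem theorem5p2:
  fixes t :: "'a::banach \<Rightarrow> 'b::banach"
    and t' :: "'a \<Rightarrow> 'a \<Rightarrow>\<^sub>L 'b"
    and \<Omega> :: "'a set"
    and xs :: 'a
    and r :: real
    and L :: "real \<Rightarrow> real"
  assumes "\<Omega> \<noteq> {}" and "open \<Omega>" and "convex \<Omega>"
    and "\<And>x. x \<in> \<Omega> \<Longrightarrow> (t has_derivative blinfun_apply (t' x)) (at x)"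
    and "r > 0" and "ball xs r \<subseteq> \<Omega>"
    and "t xs = 0"
    and "continuous_on (ball xs r) t'"
    and "blinfun_invertible (t' xs)"
    and "\<And>u. u \<in> {0<..<2 * r} \<Longrightarrow> L u > 0"
    and "set_integrable lebesgue {0<..<2 * r} L"
    and "\<And>x. x \<in> ball xs r \<Longrightarrow>
           norm (blinfun_inv (t' xs) o\<^sub>L (t' x - t' xs)) \<le> L_int L (norm (x - xs))"
    and "L_int L r \<le> 1 / 3"
  shows "\<forall>x0 \<in> ball xs r.
    (let x = two_step_x t t' x0;
         y = two_step_y t t' x0;
         \<rho> = (\<lambda>z. norm (z - xs));
         I = (\<lambda>z. L_int L (\<rho> z));
         q1 = 2 * I x0 / (1 - I x0);
         q2 = (I x0 + I (y 0)) / (1 - I x0);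
         C = q1 * (\<rho> x0 / \<rho> (y 0))
     in (\<forall>n. x n \<in> ball xs r \<and> y n \<in> ball xs r \<and> blinfun_invertible (t' (x n))) \<and>
        x \<longlonglongrightarrow> xs \<and>
        q1 < 1 \<and> q2 < 1 \<and>
        (\<forall>n. I (x n) < 1 \<and>
             norm (y n - xs) \<le> 2 * I (x n) / (1 - I (x n)) * \<rho> (x n) \<and>
             2 * I (x n) / (1 - I (x n)) * \<rho> (x n) \<le> q1 * \<rho> (x n) \<and>
             norm (x (Suc n) - xs) \<le> (I (x n) + I (y n)) / (1 - I (x n)) * \<rho> (y n) \<and>
             (I (x n) + I (y n)) / (1 - I (x n)) * \<rho> (y n) \<le> q2 * q1 * \<rho> (x n)) \<and>
        (\<forall>n\<ge>1. norm (x n - xs) \<le> (q1 * q2) ^ n * norm (x0 - xs)) \<and>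
        (\<forall>a. 0 \<le> a \<and> a \<le> 1 \<and> mono_on {0<..<2 * r} (\<lambda>f. f powr (1 - a) * L f) \<and> \<rho> (y 0) \<noteq> 0 \<longrightarrow>
             (\<forall>n\<ge>1. norm (x n - xs) \<le> C powr ((1 + 2 * a) ^ n - 1) * norm (x0 - xs))))"
proof (rule ballI, goal_cases)
  case (1 x0)
  note x0 = 1
  define x y where "x = two_step_x t t' x0" and "y = two_step_y t t' x0"
  define \<omega> where "\<omega> = L_int L"
  define a b where "a n = norm (x n - xs)" and "b n = norm (y n - xs)" for n
  define q1 q2 where "q1 = 2 * \<omega> (a 0) / (1 - \<omega> (a 0))"
    and "q2 = (\<omega> (a 0) + \<omega> (b 0)) / (1 - \<omega> (a 0))"
  have strict: "strict_mono_on {0..r} \<omega>"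
    unfolding \<omega>_def using assms by (intro strict_mono_on_L_int) auto
  have mono: "mono_on {0..<r} \<omega>"
    by (rule mono_on_subset[OF strict_mono_on_imp_mono_on[OF strict]]) auto
  have \<omega>: "0 \<le> \<omega> s \<and> \<omega> s < 1 / 3" if "0 \<le> s" "s < r" for s
    using strict_mono_onD[OF strict, of s r] mono_onD[OF mono, of 0 s] that assms(13)
    by (simp add: \<omega>_def L_int_0)
  have in_ball: "v \<in> ball xs r \<longleftrightarrow> norm (v - xs) < r" for v
    by (simp add: dist_norm norm_minus_commute)
  have substep: "blinfun_invertible (t' v)"
    "norm (newton_substep t t' v z - xs)
      \<le> (\<omega> (norm (v - xs)) + \<omega> (norm (z - xs))) / (1 - \<omega> (norm (v - xs))) * norm (z - xs)"
    if "v \<in> ball xs r" "z \<in> ball xs r" for v z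
  proof -
    have "\<omega> (norm (v - xs)) < 1" using \<omega>[of "norm (v - xs)"] that in_ball by force
    moreover have "norm (blinfun_inv (t' xs) o\<^sub>L (t' w - t' xs)) \<le> \<omega> (norm (w - xs))"
      if "w \<in> ball xs r" for w unfolding \<omega>_def using assms(12)[OF that] .
    ultimately show "blinfun_invertible (t' v)"
      "norm (newton_substep t t' v z - xs)
        \<le> (\<omega> (norm (v - xs)) + \<omega> (norm (z - xs))) / (1 - \<omega> (norm (v - xs))) * norm (z - xs)"
      using newton_substep_error[of xs r t t' \<omega> v z] assms(4,6,7,9) mono that by blast+
  qed
  have x_0: "x 0 = x0" and x_Suc: "x (Suc n) = newton_substep t t' (x n) (y n)"
    and y_eq: "y n = newton_substep t t' (x n) (x n)" for n
    by (simp_all add: x_def y_def two_step_y_def)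
  have pred: "b n \<le> 2 * \<omega> (a n) / (1 - \<omega> (a n)) * a n" if "a n < r" for n
    using substep(2)[of "x n" "x n"] that unfolding in_ball by (simp add: a_def b_def y_eq)
  have corr: "a (Suc n) \<le> (\<omega> (a n) + \<omega> (b n)) / (1 - \<omega> (a n)) * b n" if "a n < r" "b n < r" for n
    using substep(2)[of "x n" "y n"] that unfolding in_ball by (simp add: a_def b_def x_Suc)
  have a0: "a 0 < r" using x0 unfolding in_ball by (simp add: a_def x_0)
  have nonneg: "0 \<le> a n" "0 \<le> b n" for n by (simp_all add: a_def b_def)
  note maj = two_step_majorant[where a = a and b = b and \<omega> = \<omega> and r = r, OF mono \<omega> nonneg a0 pred corr,
      folded q1_def q2_def]
  have a_r: "a n < r" and b_r: "b n < r" for n using maj(1,2)[of n] a0 by linarith+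
  have balls: "x n \<in> ball xs r" "y n \<in> ball xs r" for n
    using a_r b_r unfolding in_ball by (simp_all add: a_def b_def)
  have "(\<lambda>n. (q1 * q2) ^ n * a 0) \<longlonglongrightarrow> 0"
  proof -
    have "q1 * q2 < 1" using maj(3-6) mult_strict_mono'[of q1 1 q2 1] by simp
    then show ?thesis
      using maj(3,5) by (intro tendsto_mult_left_zero LIMSEQ_realpow_zero) auto
  qed
  then have "a \<longlonglongrightarrow> 0"
    by (rule tendsto_sandwich[rotated 3]) (use maj(9) nonneg in auto)
  then have conv: "x \<longlonglongrightarrow> xs"
    unfolding a_def by (simp add: tendsto_norm_zero_iff LIM_zero_iff)
  \<comment> \<open>The base is at least \<open>1\<close> by the predictor bound at \<open>n = 0\<close>, so the power only weakens \<open>a n \<le> a 0\<close>.\<close>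
  have order_bound: "a n \<le> (q1 * (a 0 / b 0)) powr ((1 + 2 * e) ^ n - 1) * a 0"
    if "0 \<le> e" "b 0 \<noteq> 0" for e n
  proof -
    have "b 0 \<le> q1 * a 0" using pred[OF a0] by (simp add: q1_def)
    moreover have "0 < b 0" using that nonneg(2)[of 0] by simp
    ultimately have "1 \<le> q1 * (a 0 / b 0)" by (simp add: field_simps)
    then have "1 \<le> (q1 * (a 0 / b 0)) powr ((1 + 2 * e) ^ n - 1)"
      using that by (intro ge_one_powr_ge_zero) (simp_all add: one_le_power)
    then have "1 * a 0 \<le> (q1 * (a 0 / b 0)) powr ((1 + 2 * e) ^ n - 1) * a 0"
      using nonneg(1) by (rule mult_right_mono)
    then show ?thesis using maj(1)[of n] by simp
  qed
  have \<omega>_less: "\<omega> (a n) < 1" for n using \<omega>[OF nonneg(1) a_r, of n] by simp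
  have dist_x0: "norm (x0 - xs) = a 0" by (simp add: a_def x_0)
  show ?case
    unfolding Let_def
    unfolding x_def[symmetric] y_def[symmetric] \<omega>_def[symmetric] a_def[symmetric] b_def[symmetric]
      dist_x0
    unfolding q1_def[symmetric] q2_def[symmetric]
    by (intro conjI allI impI; (elim conjE)?;
        rule balls substep(1)[OF balls(1) balls(1)] conv \<omega>_less maj(4,6-9) pred[OF a_r]
          corr[OF a_r b_r] order_bound; assumption)
qed

end
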